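(* For a $T_0$ space $X$ the following are equivalent: (1) $X$ is locally compact and sober. (2) $X$ is locally compact and well-filtered. (3) $X$ is core compact and sober. (4) $X$ is core compact and well-filtered.
   Context: A space is sober if every irreducible closed set (a nonempty closed set not contained in the union of two closed sets unless contained in one of them) is the closure of a unique point. Specialization order $x\le y$ iff $x\in\overline{\{y\}}$; saturated = upper set; $\mathsf{K}(X)$ = nonempty compact saturated subsets. Well-filtered: $T_0$ and for every open $U$ and every $\mathcal K\subseteq\mathsf{K}(X)$ filtered under inclusion, $\bigcap\mathcal K\subseteq U$ implies some $K\in\mathcal K$ lies in $U$. Locally compact: every point has a neighborhood base of compact sets. Core compact: the lattice of open sets is a continuous lattice. *)

theory Defs
  imports "HOL-Analysis.Analysis"
begin

definition irreducible_closed :: "'a topology \<Rightarrow> 'a set \<Rightarrow> bool" where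
  "irreducible_closed X C \<longleftrightarrow> closedin X C \<and> C \<noteq> {} \<and>
     (\<forall>A B. closedin X A \<and> closedin X B \<and> C \<subseteq> A \<union> B \<longrightarrow> C \<subseteq> A \<or> C \<subseteq> B)"

definition sober_space :: "'a topology \<Rightarrow> bool" where
  "sober_space X \<longleftrightarrow>
     (\<forall>C. irreducible_closed X C \<longrightarrow> (\<exists>!x. x \<in> topspace X \<and> C = X closure_of {x}))"

definition spec_le :: "'a topology \<Rightarrow> 'a \<Rightarrow> 'a \<Rightarrow> bool" where
  "spec_le X x y \<longleftrightarrow> x \<in> X closure_of {y}"

definition saturatedin :: "'a topology \<Rightarrow> 'a set \<Rightarrow> bool" where
  "saturatedin X S \<longleftrightarrow> S \<subseteq> topspace X \<and>
     (\<forall>x\<in>S. \<forall>y\<in>topspace X. spec_le X x y \<longrightarrow> y \<in> S)"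

definition KX :: "'a topology \<Rightarrow> 'a set set" where
  "KX X = {K. K \<noteq> {} \<and> compactin X K \<and> saturatedin X K}"

definition filtered_family :: "'a set set \<Rightarrow> bool" where
  "filtered_family \<K> \<longleftrightarrow> \<K> \<noteq> {} \<and>
     (\<forall>K1\<in>\<K>. \<forall>K2\<in>\<K>. \<exists>K3\<in>\<K>. K3 \<subseteq> K1 \<and> K3 \<subseteq> K2)"

definition well_filtered_space :: "'a topology \<Rightarrow> bool" where
  "well_filtered_space X \<longleftrightarrow> t0_space X \<and>
     (\<forall>U \<K>. openin X U \<and> \<K> \<subseteq> KX X \<and> filtered_family \<K> \<and> \<Inter>\<K> \<subseteq> U
        \<longrightarrow> (\<exists>K\<in>\<K>. K \<subseteq> U))"

definition loc_compact_space :: "'a topology \<Rightarrow> bool" where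
  "loc_compact_space X \<longleftrightarrow> neighbourhood_base_of (compactin X) X"

definition directed_family :: "'a set set \<Rightarrow> bool" where
  "directed_family \<D> \<longleftrightarrow> \<D> \<noteq> {} \<and>
     (\<forall>D1\<in>\<D>. \<forall>D2\<in>\<D>. \<exists>D3\<in>\<D>. D1 \<subseteq> D3 \<and> D2 \<subseteq> D3)"

text \<open>Way-below relation in the complete lattice of open sets (joins are unions).\<close>
definition open_way_below :: "'a topology \<Rightarrow> 'a set \<Rightarrow> 'a set \<Rightarrow> bool" where
  "open_way_below X U V \<longleftrightarrow>
     (\<forall>\<D>. (\<forall>D\<in>\<D>. openin X D) \<and> directed_family \<D> \<and> V \<subseteq> \<Union>\<D> \<longrightarrow> (\<exists>D\<in>\<D>. U \<subseteq> D))"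

text \<open>Core compact: the lattice of open sets is a continuous lattice, i.e. every open V
is the directed join of the open sets way below it.\<close>
definition core_compact_space :: "'a topology \<Rightarrow> bool" where
  "core_compact_space X \<longleftrightarrow>
     (\<forall>V. openin X V \<longrightarrow>
        directed_family {U. openin X U \<and> open_way_below X U V} \<and>
        V = \<Union>{U. openin X U \<and> open_way_below X U V})"

end

theory Submission
  imports Defs
begin

text \<open>
  Core compactness and well-filteredness together give local compactness. By interpolation,
  a way-below pair \<open>V\<close>, \<open>W\<close> of opens extends to a chain \<open>W = W\<^sub>0, W\<^sub>1, \<dots>\<close> above \<open>V\<close>, each
  \<open>W\<^sub>n\<^sub>+\<^sub>1\<close> way below \<open>W\<^sub>n\<close>, and the intersection of the \<open>W\<^sub>n\<close> is compact as soon as every open set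
  \<open>U\<close> containing it contains some \<open>W\<^sub>n\<close>. If some \<open>U\<close> violates this, Zorn's lemma enlarges it to an
  open set \<open>M\<close> maximal among those containing no \<open>W\<^sub>n\<close>. Choose points \<open>x\<^sub>n\<close> in \<open>W\<^sub>n\<close> outside \<open>M\<close>.
  By maximality, every open set not contained in \<open>M\<close> contains all but finitely many of the \<open>x\<^sub>n\<close>,
  so each tail of the sequence is compact. The saturations of the tails are filtered with
  intersection inside \<open>M\<close>, but none of them lies in \<open>M\<close>, contradicting well-filteredness.
  In a locally compact well-filtered space, the compact saturated sets whose interior meets an
  irreducible closed set \<open>C\<close> are filtered, and a point of \<open>C\<close> common to all of them is generic in \<open>C\<close>.
  Conversely, in a sober space, if no member of a filtered family of compact saturated sets lies in
  the open set \<open>U\<close>, an open \<open>M\<close> containing \<open>U\<close> and maximal with this property has an irreducible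
  complement, whose generic point belongs to every member of the family but not to \<open>U\<close>.
\<close>

section \<open>Saturation and the specialization order\<close>

definition saturation_of :: "'a topology \<Rightarrow> 'a set \<Rightarrow> 'a set" where
  "saturation_of X S = {y \<in> topspace X. \<exists>x\<in>S. spec_le X x y}"

lemma spec_le_iff:
  "spec_le X x y \<longleftrightarrow> x \<in> topspace X \<and> (\<forall>T. openin X T \<and> x \<in> T \<longrightarrow> y \<in> T)"
  unfolding spec_le_def in_closure_of by auto

lemma subset_saturation_of: "S \<subseteq> topspace X \<Longrightarrow> S \<subseteq> saturation_of X S"
  unfolding saturation_of_def spec_le_iff by auto

lemma saturation_of_subset_open: "openin X U \<Longrightarrow> S \<subseteq> U \<Longrightarrow> saturation_of X S \<subseteq> U"
  unfolding saturation_of_def spec_le_iff by auto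

lemma saturation_of_mono: "S \<subseteq> T \<Longrightarrow> saturation_of X S \<subseteq> saturation_of X T"
  unfolding saturation_of_def by auto

lemma saturatedin_saturation_of: "saturatedin X (saturation_of X S)"
  unfolding saturatedin_def saturation_of_def spec_le_iff by auto

text \<open>Open sets are upper sets, so a finite subfamily covering \<open>S\<close> already covers
  its saturation.\<close>

lemma compactin_saturation_of:
  assumes "compactin X S"
  shows "compactin X (saturation_of X S)"
  unfolding compactin_def
proof (intro conjI allI impI)
  show "saturation_of X S \<subseteq> topspace X"
    unfolding saturation_of_def by auto
next
  fix \<U> assume \<U>: "(\<forall>U\<in>\<U>. openin X U) \<and> saturation_of X S \<subseteq> \<Union>\<U>"
  have "S \<subseteq> \<Union>\<U>"
    using subset_saturation_of[OF compactin_subset_topspace[OF assms]] \<U> by blast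
  then obtain \<F> where "finite \<F>" "\<F> \<subseteq> \<U>" "S \<subseteq> \<Union>\<F>"
    using compactinD[OF assms, of \<U>] \<U> by blast
  then show "\<exists>\<F>. finite \<F> \<and> \<F> \<subseteq> \<U> \<and> saturation_of X S \<subseteq> \<Union>\<F>"
    using \<U> by (meson openin_Union saturation_of_subset_open subsetD)
qed

text \<open>Well-filteredness speaks only of members of \<open>KX\<close>; this supplies them from
  arbitrary nonempty compact sets.\<close>

lemma saturation_of_in_KX:
  assumes "compactin X S" "S \<noteq> {}"
  shows "saturation_of X S \<in> KX X"
  using assms compactin_saturation_of[OF assms(1)] saturatedin_saturation_of[of X S]
    subset_saturation_of[OF compactin_subset_topspace[OF assms(1)]]
  unfolding KX_def by auto

section \<open>Directed families and maximal open sets\<close>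

lemma directed_family_finite_upper_bound:
  assumes "directed_family \<D>" "finite \<F>" "\<F> \<subseteq> \<D>"
  shows "\<exists>D\<in>\<D>. \<Union>\<F> \<subseteq> D"
  using assms(2,3)
proof (induction rule: finite_induct)
  case empty
  then show ?case using assms(1) unfolding directed_family_def by auto
next
  case (insert A \<F>)
  then obtain D where "D \<in> \<D>" "\<Union>\<F> \<subseteq> D" by auto
  moreover obtain E where "E \<in> \<D>" "A \<subseteq> E" "D \<subseteq> E"
    using assms(1) insert.prems \<open>D \<in> \<D>\<close> unfolding directed_family_def
    by (metis insert_subset)
  ultimately show ?case by auto
qed

lemma compactin_directed_family:
  assumes "compactin X K" "directed_family \<D>" "\<And>D. D \<in> \<D> \<Longrightarrow> openin X D" "K \<subseteq> \<Union>\<D>"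
  shows "\<exists>D\<in>\<D>. K \<subseteq> D"
  using compactinD[OF assms(1,3,4)] directed_family_finite_upper_bound[OF assms(2)]
  by (meson order_trans)

text \<open>Replaces an arbitrary cover by a directed one, so that statements about directed
  families yield finite subcovers.\<close>

lemma directed_family_finite_unions:
  "directed_family {\<Union>\<F> | \<F>. finite \<F> \<and> \<F> \<subseteq> \<U>}"
  unfolding directed_family_def
proof (intro conjI ballI)
  show "{\<Union>\<F> | \<F>. finite \<F> \<and> \<F> \<subseteq> \<U>} \<noteq> {}" by auto
next
  fix D1 D2
  assume "D1 \<in> {\<Union>\<F> | \<F>. finite \<F> \<and> \<F> \<subseteq> \<U>}" "D2 \<in> {\<Union>\<F> | \<F>. finite \<F> \<and> \<F> \<subseteq> \<U>}"
  then obtain \<F> \<G> where "D1 = \<Union>\<F>" "finite \<F>" "\<F> \<subseteq> \<U>" "D2 = \<Union>\<G>" "finite \<G>" "\<G> \<subseteq> \<U>"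
    by auto
  then have "\<Union>(\<F> \<union> \<G>) \<in> {\<Union>\<F> | \<F>. finite \<F> \<and> \<F> \<subseteq> \<U>}" "D1 \<subseteq> \<Union>(\<F> \<union> \<G>)" "D2 \<subseteq> \<Union>(\<F> \<union> \<G>)"
    by (blast intro: finite_UnI)+
  then show "\<exists>D3\<in>{\<Union>\<F> | \<F>. finite \<F> \<and> \<F> \<subseteq> \<U>}. D1 \<subseteq> D3 \<and> D2 \<subseteq> D3" by meson
qed

text \<open>Chains are directed, so inaccessibility of \<open>F\<close> by directed unions keeps the
  union of a chain outside \<open>F\<close>, and Zorn's lemma applies. \<open>F\<close> will be the
  collection of supersets of members of a filtered family or of a decreasing sequence.\<close>

lemma maximal_open_outside:
  assumes inaccessible: "\<And>\<D>. directed_family \<D> \<Longrightarrow> (\<And>D. D \<in> \<D> \<Longrightarrow> openin X D) \<Longrightarrow>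
      \<Union>\<D> \<in> F \<Longrightarrow> \<exists>D\<in>\<D>. D \<in> F"
    and "openin X U" "U \<notin> F"
  obtains M where "openin X M" "U \<subseteq> M" "M \<notin> F"
    "\<And>V. openin X V \<Longrightarrow> M \<subseteq> V \<Longrightarrow> V \<notin> F \<Longrightarrow> V = M"
proof -
  define \<A> where "\<A> = {V. openin X V \<and> U \<subseteq> V \<and> V \<notin> F}"
  have "\<exists>M\<in>\<A>. \<forall>V\<in>\<A>. M \<subseteq> V \<longrightarrow> V = M"
  proof (rule subset_Zorn_nonempty)
    show "\<A> \<noteq> {}" using assms(2,3) unfolding \<A>_def by auto
  next
    fix \<C> assume "\<C> \<noteq> {}" and chain: "subset.chain \<A> \<C>"
    then have "\<C> \<subseteq> \<A>" unfolding subset_chain_def by auto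
    moreover have "directed_family \<C>"
      using \<open>\<C> \<noteq> {}\<close> chain unfolding directed_family_def subset_chain_def
      by (metis order_refl)
    ultimately have "\<Union>\<C> \<notin> F"
      using inaccessible[of \<C>] unfolding \<A>_def by blast
    then show "\<Union>\<C> \<in> \<A>"
      using \<open>\<C> \<subseteq> \<A>\<close> \<open>\<C> \<noteq> {}\<close> unfolding \<A>_def by (auto intro!: openin_Union)
  qed
  then obtain M where "M \<in> \<A>" "\<And>V. V \<in> \<A> \<Longrightarrow> M \<subseteq> V \<Longrightarrow> V = M" by blast
  then show thesis
    using that[of M] unfolding \<A>_def by auto
qed

section \<open>From sobriety to well-filteredness\<close>

lemma sober_imp_well_filtered:
  assumes "t0_space X" "sober_space X"
  shows "well_filtered_space X"
  unfolding well_filtered_space_def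
proof (intro conjI allI impI)
  show "t0_space X" by fact
next
  fix U \<K> assume *: "openin X U \<and> \<K> \<subseteq> KX X \<and> filtered_family \<K> \<and> \<Inter>\<K> \<subseteq> U"
  define F where "F = {V. \<exists>K\<in>\<K>. K \<subseteq> V}"
  have "U \<in> F"
  proof (rule ccontr)
    assume "U \<notin> F"
    \<comment> \<open>This is compactness of the members of \<open>\<K>\<close>: a directed open
      cover of \<open>K\<close> has a single member containing \<open>K\<close>.\<close>
    have inacc: "\<exists>D\<in>\<D>. D \<in> F"
      if \<D>: "directed_family \<D>" "\<And>D. D \<in> \<D> \<Longrightarrow> openin X D" "\<Union>\<D> \<in> F" for \<D>
    proof -
      obtain K where "K \<in> \<K>" "K \<subseteq> \<Union>\<D>" using \<D>(3) unfolding F_def by auto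
      moreover have "compactin X K" using * \<open>K \<in> \<K>\<close> unfolding KX_def by auto
      ultimately obtain D where "D \<in> \<D>" "K \<subseteq> D"
        using compactin_directed_family[OF _ \<D>(1,2)] by blast
      then show ?thesis using \<open>K \<in> \<K>\<close> unfolding F_def by auto
    qed
    obtain M where M: "openin X M" "U \<subseteq> M" "M \<notin> F"
      and max: "\<And>V. openin X V \<Longrightarrow> M \<subseteq> V \<Longrightarrow> V \<notin> F \<Longrightarrow> V = M"
      by (rule maximal_open_outside[of X F, OF inacc _ \<open>U \<notin> F\<close>]) (use * in auto)
    define C where "C = topspace X - M"
    have meets: "K \<inter> C \<noteq> {}" if "K \<in> \<K>" for K
    proof -
      have "K \<subseteq> topspace X" using that * unfolding KX_def saturatedin_def by auto
      moreover have "\<not> K \<subseteq> M" using that M(3) unfolding F_def by auto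
      ultimately show ?thesis unfolding C_def by auto
    qed
    have "irreducible_closed X C"
      unfolding irreducible_closed_def
    proof (intro conjI allI impI)
      show "closedin X C" unfolding C_def using M(1) by auto
      show "C \<noteq> {}" using meets * unfolding filtered_family_def by blast
    next
      fix A B assume AB: "closedin X A \<and> closedin X B \<and> C \<subseteq> A \<union> B"
      \<comment> \<open>The complement of \<open>A\<close> meets \<open>C\<close>, so adjoining it
        enlarges \<open>M\<close> properly, and maximality forces the result into
        \<open>F\<close>.\<close>
      have in_F: "M \<union> (topspace X - A) \<in> F" if "closedin X A" "\<not> C \<subseteq> A" for A
      proof (rule ccontr)
        assume "M \<union> (topspace X - A) \<notin> F"
        then have "M \<union> (topspace X - A) = M"
          using M(1) that(1) by (intro max) auto
        then show False using that(2) unfolding C_def by auto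
      qed
      show "C \<subseteq> A \<or> C \<subseteq> B"
      proof (rule ccontr)
        assume "\<not> (C \<subseteq> A \<or> C \<subseteq> B)"
        then have "M \<union> (topspace X - A) \<in> F" "M \<union> (topspace X - B) \<in> F"
          using in_F[of A] in_F[of B] AB by auto
        then obtain K1 K2 where K12: "K1 \<in> \<K>" "K1 \<subseteq> M \<union> (topspace X - A)"
            "K2 \<in> \<K>" "K2 \<subseteq> M \<union> (topspace X - B)"
          unfolding F_def by auto
        then obtain K3 where "K3 \<in> \<K>" "K3 \<subseteq> K1" "K3 \<subseteq> K2"
          using * unfolding filtered_family_def by meson
        \<comment> \<open>The intersection is \<open>M\<close> together with the complement of
          \<open>A \<union> B\<close>, which misses \<open>C\<close> and hence lies in
          \<open>M\<close>.\<close>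
        moreover have "(M \<union> (topspace X - A)) \<inter> (M \<union> (topspace X - B)) \<subseteq> M"
          using AB unfolding C_def by auto
        ultimately have "K3 \<subseteq> M" using K12 by blast
        then show False using M(3) \<open>K3 \<in> \<K>\<close> unfolding F_def by auto
      qed
    qed
    then obtain x where x: "x \<in> topspace X" "C = X closure_of {x}"
      using assms(2) unfolding sober_space_def by blast
    \<comment> \<open>\<open>K\<close> meets \<open>C\<close>, so it has a point below the generic
      point \<open>x\<close>; saturation then brings \<open>x\<close> into \<open>K\<close>.\<close>
    have "x \<in> K" if K: "K \<in> \<K>" for K
    proof -
      obtain k where "k \<in> K" "spec_le X k x"
        using meets[OF K] x(2) unfolding spec_le_def by auto
      then show ?thesis
        using K * x(1) unfolding KX_def saturatedin_def by blast
    qed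
    then have "x \<in> \<Inter>\<K>" by auto
    then have "x \<in> M" using * M(2) by blast
    moreover have "x \<in> C" using x closure_of_subset[of "{x}" X] by auto
    ultimately show False unfolding C_def by auto
  qed
  then show "\<exists>K\<in>\<K>. K \<subseteq> U" unfolding F_def by auto
qed

section \<open>The way-below relation on open sets and core compactness\<close>

lemma open_way_below_subset:
  assumes "open_way_below X U V" "openin X V"
  shows "U \<subseteq> V"
proof -
  have "directed_family {V}" unfolding directed_family_def by auto
  then show ?thesis
    using assms(1)[unfolded open_way_below_def, rule_format, of "{V}"] assms(2) by auto
qed

lemma open_way_below_mono:
  "open_way_below X U V \<Longrightarrow> U' \<subseteq> U \<Longrightarrow> V \<subseteq> V' \<Longrightarrow> open_way_below X U' V'"
  unfolding open_way_below_def by (meson order_trans)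

lemma open_way_below_empty: "open_way_below X {} V"
  unfolding open_way_below_def directed_family_def by auto

lemma open_way_below_Un:
  assumes "open_way_below X U V" "open_way_below X U' V'"
  shows "open_way_below X (U \<union> U') (V \<union> V')"
  unfolding open_way_below_def
proof (intro allI impI)
  fix \<D> assume \<D>: "(\<forall>D\<in>\<D>. openin X D) \<and> directed_family \<D> \<and> V \<union> V' \<subseteq> \<Union>\<D>"
  then have "V \<subseteq> \<Union>\<D>" "V' \<subseteq> \<Union>\<D>" by auto
  with \<D> obtain D D' where "D \<in> \<D>" "U \<subseteq> D" "D' \<in> \<D>" "U' \<subseteq> D'"
    using assms unfolding open_way_below_def by meson
  moreover obtain E where "E \<in> \<D>" "D \<subseteq> E" "D' \<subseteq> E"
    using \<D> \<open>D \<in> \<D>\<close> \<open>D' \<in> \<D>\<close> unfolding directed_family_def by meson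
  ultimately show "\<exists>D\<in>\<D>. U \<union> U' \<subseteq> D" by (meson Un_least order_trans)
qed

text \<open>An open set inside a compact subset of \<open>V\<close> is way below \<open>V\<close>,
  and local compactness provides one around each point of \<open>V\<close>.\<close>

lemma loc_compact_imp_core_compact:
  assumes "loc_compact_space X"
  shows "core_compact_space X"
  unfolding core_compact_space_def
proof (intro allI impI)
  fix V assume V: "openin X V"
  let ?B = "{U. openin X U \<and> open_way_below X U V}"
  have "U1 \<union> U2 \<in> ?B" if "U1 \<in> ?B" "U2 \<in> ?B" for U1 U2
    using that open_way_below_Un[of X U1 V U2 V] by auto
  moreover have "{} \<in> ?B" using open_way_below_empty by auto
  ultimately have "directed_family ?B"
    unfolding directed_family_def by (metis (no_types, lifting) Un_upper1 Un_upper2 empty_iff)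
  moreover have "V \<subseteq> \<Union>?B"
  proof
    fix x assume "x \<in> V"
    then obtain U K where UK: "openin X U" "compactin X K" "x \<in> U" "U \<subseteq> K" "K \<subseteq> V"
      using assms V unfolding loc_compact_space_def neighbourhood_base_of by meson
    have "open_way_below X U V"
      unfolding open_way_below_def
    proof (intro allI impI)
      fix \<D> assume \<D>: "(\<forall>D\<in>\<D>. openin X D) \<and> directed_family \<D> \<and> V \<subseteq> \<Union>\<D>"
      then show "\<exists>D\<in>\<D>. U \<subseteq> D"
        using compactin_directed_family[OF UK(2), of \<D>] UK(4,5) by (meson order_trans)
    qed
    then show "x \<in> \<Union>?B" using UK by auto
  qed
  moreover have "\<Union>?B \<subseteq> V" using open_way_below_subset V by blast
  ultimately show "directed_family ?B \<and> V = \<Union>?B" by blast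
qed

lemma core_compact_way_below_point:
  assumes "core_compact_space X" "openin X V" "x \<in> V"
  obtains U where "openin X U" "open_way_below X U V" "x \<in> U"
proof -
  have "x \<in> \<Union>{U. openin X U \<and> open_way_below X U V}"
    using assms unfolding core_compact_space_def by simp
  then show thesis using that by auto
qed

text \<open>The open sets two way-below steps under \<open>V\<close> form a directed family, which
  covers \<open>V\<close> by core compactness used twice. Hence \<open>U\<close> lies in one of
  them, and the intermediate set is the interpolant.\<close>

lemma core_compact_interpolation:
  assumes "core_compact_space X" "openin X V" "open_way_below X U V"
  obtains W where "openin X W" "open_way_below X U W" "open_way_below X W V"
proof -
  define \<D> where
    "\<D> = {W. openin X W \<and> (\<exists>W'. openin X W' \<and> open_way_below X W W' \<and> open_way_below X W' V)}"
  have "directed_family \<D>"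
    unfolding directed_family_def
  proof (intro conjI ballI)
    show "\<D> \<noteq> {}" unfolding \<D>_def using open_way_below_empty openin_empty by blast
  next
    fix D1 D2 assume "D1 \<in> \<D>" "D2 \<in> \<D>"
    then obtain W1 W2 where "openin X D1" "openin X W1" "open_way_below X D1 W1" "open_way_below X W1 V"
        "openin X D2" "openin X W2" "open_way_below X D2 W2" "open_way_below X W2 V"
      unfolding \<D>_def by blast
    then have "D1 \<union> D2 \<in> \<D>"
      unfolding \<D>_def using open_way_below_Un[of X D1 W1 D2 W2] open_way_below_Un[of X W1 V W2 V]
      by auto
    then show "\<exists>D3\<in>\<D>. D1 \<subseteq> D3 \<and> D2 \<subseteq> D3" by blast
  qed
  moreover have "V \<subseteq> \<Union>\<D>"
  proof
    fix x assume "x \<in> V"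
    with assms(1,2) obtain W where W: "openin X W" "open_way_below X W V" "x \<in> W"
      by (rule core_compact_way_below_point)
    moreover obtain W' where "openin X W'" "open_way_below X W' W" "x \<in> W'"
      using assms(1) W(1,3) by (rule core_compact_way_below_point)
    ultimately show "x \<in> \<Union>\<D>" unfolding \<D>_def by blast
  qed
  moreover have "\<forall>D\<in>\<D>. openin X D" unfolding \<D>_def by blast
  ultimately obtain D where "D \<in> \<D>" "U \<subseteq> D"
    using assms(3) unfolding open_way_below_def by meson
  then show thesis
    using that unfolding \<D>_def by (blast intro: open_way_below_mono)
qed

section \<open>Compact intersections of way-below chains\<close>

lemma way_below_chain_inaccessible:
  assumes "\<And>n. open_way_below X (W (Suc n)) (W n)"
    and "directed_family \<D>" "\<And>D. D \<in> \<D> \<Longrightarrow> openin X D"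
    and "\<Union>\<D> \<in> {V. \<exists>n. W n \<subseteq> V}"
  shows "\<exists>D\<in>\<D>. D \<in> {V. \<exists>n. W n \<subseteq> V}"
proof -
  \<comment> \<open>Passing to a member of \<open>\<D>\<close> costs one index of the chain, which
    is harmless because membership asks only for some \<open>n\<close>.\<close>
  obtain n where "W n \<subseteq> \<Union>\<D>" using assms(4) by auto
  then obtain D where "D \<in> \<D>" "W (Suc n) \<subseteq> D"
    using assms(1)[of n] assms(2,3) unfolding open_way_below_def by meson
  then show ?thesis by blast
qed

lemma way_below_chain_Inter_subset_open:
  fixes W :: "nat \<Rightarrow> 'a set"
  assumes wf: "well_filtered_space X"
    and W: "\<And>n. openin X (W n)" "\<And>n. open_way_below X (W (Suc n)) (W n)"
    and U: "openin X U" "(\<Inter>n. W n) \<subseteq> U"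
  shows "\<exists>n. W n \<subseteq> U"
proof (rule ccontr)
  assume nex: "\<nexists>n. W n \<subseteq> U"
  let ?F = "{V. \<exists>n. W n \<subseteq> V}"
  obtain M where M: "openin X M" "U \<subseteq> M" "M \<notin> ?F"
    and max: "\<And>V. openin X V \<Longrightarrow> M \<subseteq> V \<Longrightarrow> V \<notin> ?F \<Longrightarrow> V = M"
    by (rule maximal_open_outside[of X ?F, OF way_below_chain_inaccessible[of X W, OF W(2)] U(1)])
      (use nex in auto)
  have "antimono W"
    by (rule antimonoI, rule lift_Suc_antimono_le) (use W open_way_below_subset in blast)+
  have "\<exists>x. x \<in> W n - M" for n using M(3) by auto
  then obtain x where x: "\<And>n. x n \<in> W n - M" by metis
  have x_top: "x n \<in> topspace X" for n using x W(1)[of n] openin_subset by blast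
  have tail: "\<exists>m. \<forall>k\<ge>m. x k \<in> V" if "openin X V" "x n \<in> V" for V n
  proof -
    \<comment> \<open>\<open>x n\<close> lies in \<open>V\<close> but not in \<open>M\<close>, so
      \<open>M \<union> V\<close> is properly larger than \<open>M\<close>. Once some
      \<open>W m\<close> lies in it, the later \<open>x k\<close>, being outside \<open>M\<close>,
      must be in \<open>V\<close>.\<close>
    have "M \<union> V \<in> ?F"
      using max[of "M \<union> V"] M(1) that x[of n] by blast
    then obtain m where "W m \<subseteq> M \<union> V" by auto
    then show ?thesis
      using x \<open>antimono W\<close> unfolding monotone_def by blast
  qed
  define S where "S n = x ` {n..}" for n
  have "compactin X (S n)" for n
    unfolding compactin_def
  proof (intro conjI allI impI)
    show "S n \<subseteq> topspace X" using x_top unfolding S_def by auto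
  next
    fix \<U> assume \<U>: "(\<forall>U\<in>\<U>. openin X U) \<and> S n \<subseteq> \<Union>\<U>"
    have "x n \<in> S n" unfolding S_def by auto
    \<comment> \<open>One member \<open>V\<close> of the cover takes care of all indices from
      \<open>m\<close> on; only the finitely many in \<open>{n..<m}\<close> need their own
      \<open>T k\<close>.\<close>
    then obtain V where V: "V \<in> \<U>" "x n \<in> V" using \<U> by auto
    then obtain m where m: "\<And>k. k \<ge> m \<Longrightarrow> x k \<in> V" using tail \<U> by blast
    have "\<forall>k\<in>{n..}. \<exists>T. T \<in> \<U> \<and> x k \<in> T" using \<U> unfolding S_def by auto
    then obtain T where T: "\<And>k. k \<ge> n \<Longrightarrow> T k \<in> \<U> \<and> x k \<in> T k" by (metis atLeast_iff)
    have "S n \<subseteq> \<Union>(insert V (T ` {n..<m}))"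
    proof
      fix y assume "y \<in> S n"
      then obtain k where "y = x k" "k \<ge> n" unfolding S_def by auto
      then show "y \<in> \<Union>(insert V (T ` {n..<m}))"
        using m[of k] T[of k] by (cases "k \<ge> m") auto
    qed
    moreover have "insert V (T ` {n..<m}) \<subseteq> \<U>" using T V by auto
    ultimately show "\<exists>\<F>. finite \<F> \<and> \<F> \<subseteq> \<U> \<and> S n \<subseteq> \<Union>\<F>"
      by (meson finite_imageI finite_insert finite_atLeastLessThan)
  qed
  then have "range (\<lambda>n. saturation_of X (S n)) \<subseteq> KX X"
    using saturation_of_in_KX[of X "S _"] unfolding S_def by auto
  moreover have "filtered_family (range (\<lambda>n. saturation_of X (S n)))"
  proof -
    have "saturation_of X (S (max i j)) \<subseteq> saturation_of X (S i) \<and>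
        saturation_of X (S (max i j)) \<subseteq> saturation_of X (S j)" for i j
      by (intro conjI saturation_of_mono) (auto simp: S_def)
    then show ?thesis
      unfolding filtered_family_def by (simp, meson)
  qed
  moreover have "(\<Inter>n. saturation_of X (S n)) \<subseteq> M"
  proof -
    have "S n \<subseteq> W n" for n
      using x \<open>antimono W\<close> unfolding S_def monotone_def by blast
    then have "saturation_of X (S n) \<subseteq> W n" for n
      using saturation_of_subset_open[OF W(1)] by simp
    then have "(\<Inter>n. saturation_of X (S n)) \<subseteq> (\<Inter>n. W n)" by (intro INF_superset_mono order_refl)
    then show ?thesis using U(2) M(2) by (meson order_trans)
  qed
  ultimately have "\<exists>K\<in>range (\<lambda>n. saturation_of X (S n)). K \<subseteq> M"
    using wf M(1) unfolding well_filtered_space_def by meson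
  then obtain n where "saturation_of X (S n) \<subseteq> M" by auto
  then have "S n \<subseteq> M"
    using x_top subset_saturation_of[of "S n" X] unfolding S_def by auto
  then show False using x[of n] unfolding S_def by auto
qed

lemma core_compact_well_filtered_imp_loc_compact:
  assumes cc: "core_compact_space X" and wf: "well_filtered_space X"
  shows "loc_compact_space X"
  unfolding loc_compact_space_def neighbourhood_base_of
proof (intro allI impI)
  fix G x assume G: "openin X G \<and> x \<in> G"
  with cc obtain V where V: "openin X V" "open_way_below X V G" "x \<in> V"
    using core_compact_way_below_point by metis
  \<comment> \<open>The chain starts at \<open>G\<close>, which keeps the intersection inside
    \<open>G\<close>; each further term interpolates between \<open>V\<close> and its predecessor,
    which keeps \<open>V\<close> below all of them.\<close>
  have "\<exists>W. \<forall>n. (openin X (W n) \<and> open_way_below X V (W n) \<and> (n = 0 \<longrightarrow> W n = G)) \<and>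
      open_way_below X (W (Suc n)) (W n)"
  proof (rule dependent_nat_choice)
    show "\<exists>W. openin X W \<and> open_way_below X V W \<and> (0 = (0::nat) \<longrightarrow> W = G)" using G V by auto
  next
    fix W and n :: nat
    assume "openin X W \<and> open_way_below X V W \<and> (n = 0 \<longrightarrow> W = G)"
    then show "\<exists>W'. (openin X W' \<and> open_way_below X V W' \<and> (Suc n = 0 \<longrightarrow> W' = G)) \<and>
        open_way_below X W' W"
      using core_compact_interpolation[OF cc] by (metis nat.distinct(1))
  qed
  then obtain W where W: "\<And>n. openin X (W n)" "\<And>n. open_way_below X (W (Suc n)) (W n)"
    and VW: "\<And>n. open_way_below X V (W n)" and "W 0 = G"
    by blast
  have "V \<subseteq> (\<Inter>n. W n)" using VW W(1) open_way_below_subset by blast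
  moreover have "(\<Inter>n. W n) \<subseteq> G" using \<open>W 0 = G\<close> by auto
  moreover have "compactin X (\<Inter>n. W n)"
    unfolding compactin_def
  proof (intro conjI allI impI)
    show "(\<Inter>n. W n) \<subseteq> topspace X" using W(1) openin_subset by blast
  next
    fix \<U> assume \<U>: "(\<forall>U\<in>\<U>. openin X U) \<and> (\<Inter>n. W n) \<subseteq> \<Union>\<U>"
    then have "openin X (\<Union>\<U>)" by (blast intro: openin_Union)
    then obtain n where "W n \<subseteq> \<Union>\<U>"
      using way_below_chain_Inter_subset_open[of X W, OF wf W] \<U> by blast
    \<comment> \<open>The finite unions have the same total union as \<open>\<U>\<close> but are
      directed, so one of them contains \<open>W (Suc n)\<close> and with it the whole
      intersection.\<close>
    then have "W n \<subseteq> \<Union>{\<Union>\<F> | \<F>. finite \<F> \<and> \<F> \<subseteq> \<U>}"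
      by (auto intro!: exI[of _ "{_}"])
    moreover have "\<forall>D\<in>{\<Union>\<F> | \<F>. finite \<F> \<and> \<F> \<subseteq> \<U>}. openin X D"
      using \<U> by (auto intro: openin_Union)
    ultimately have "\<exists>D\<in>{\<Union>\<F> | \<F>. finite \<F> \<and> \<F> \<subseteq> \<U>}. W (Suc n) \<subseteq> D"
      using W(2)[of n] directed_family_finite_unions[of \<U>] unfolding open_way_below_def by meson
    then obtain \<F> where "finite \<F>" "\<F> \<subseteq> \<U>" "W (Suc n) \<subseteq> \<Union>\<F>" by blast
    moreover have "(\<Inter>n. W n) \<subseteq> W (Suc n)" by auto
    ultimately show "\<exists>\<F>. finite \<F> \<and> \<F> \<subseteq> \<U> \<and> (\<Inter>n. W n) \<subseteq> \<Union>\<F>" by (meson order_trans)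
  qed
  ultimately show "\<exists>U V. openin X U \<and> compactin X V \<and> x \<in> U \<and> U \<subseteq> V \<and> V \<subseteq> G"
    using V by meson
qed

section \<open>Generic points in locally compact well-filtered spaces\<close>

lemma t0_space_closure_of_singleton_inj:
  assumes "t0_space X" "x \<in> topspace X" "y \<in> topspace X" "X closure_of {x} = X closure_of {y}"
  shows "x = y"
proof -
  have "x \<in> X closure_of {y}" "y \<in> X closure_of {x}"
    using assms(2-4) closure_of_subset[of "{_}" X] by auto
  then have "x \<in> T \<longleftrightarrow> y \<in> T" if "openin X T" for T
    using that unfolding in_closure_of by auto
  then show ?thesis
    using assms(1-3) unfolding t0_space_def by metis
qed

lemma loc_compact_well_filtered_imp_sober:
  assumes lc: "loc_compact_space X" and wf: "well_filtered_space X"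
  shows "sober_space X"
  unfolding sober_space_def
proof (intro allI impI ex_ex1I)
  fix C assume C: "irreducible_closed X C"
  then have clC: "closedin X C" unfolding irreducible_closed_def by auto
  define \<K> where "\<K> = {K \<in> KX X. \<exists>G. openin X G \<and> G \<subseteq> K \<and> G \<inter> C \<noteq> {}}"
  \<comment> \<open>Local compactness at a point of \<open>G \<inter> C\<close> gives a compact
    neighbourhood inside \<open>G\<close>; its saturation stays in \<open>G\<close> because
    \<open>G\<close> is open.\<close>
  have small: "\<exists>K\<in>\<K>. K \<subseteq> G" if G: "openin X G" "G \<inter> C \<noteq> {}" for G
  proof -
    obtain y where "y \<in> G" "y \<in> C" using G by auto
    then obtain U K where UK: "openin X U" "compactin X K" "y \<in> U" "U \<subseteq> K" "K \<subseteq> G"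
      using lc G(1) unfolding loc_compact_space_def neighbourhood_base_of by meson
    have "saturation_of X K \<in> KX X" using UK by (intro saturation_of_in_KX) auto
    moreover have "U \<subseteq> saturation_of X K"
      using UK(4) subset_saturation_of[OF compactin_subset_topspace[OF UK(2)]] by auto
    ultimately have "saturation_of X K \<in> \<K>"
      unfolding \<K>_def using UK \<open>y \<in> C\<close> by blast
    moreover have "saturation_of X K \<subseteq> G" using saturation_of_subset_open G(1) UK(5) by blast
    ultimately show ?thesis by blast
  qed
  \<comment> \<open>Irreducibility in terms of open sets: otherwise the two complements would cover
    \<open>C\<close> with neither containing it.\<close>
  have meet: "O1 \<inter> O2 \<inter> C \<noteq> {}"
    if "openin X O1" "O1 \<inter> C \<noteq> {}" "openin X O2" "O2 \<inter> C \<noteq> {}" for O1 O2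
  proof
    assume "O1 \<inter> O2 \<inter> C = {}"
    then have "C \<subseteq> (topspace X - O1) \<union> (topspace X - O2)"
      using closedin_subset[OF clC] by auto
    then have "C \<subseteq> topspace X - O1 \<or> C \<subseteq> topspace X - O2"
      using C that(1,3) unfolding irreducible_closed_def by blast
    then show False using that by auto
  qed
  have "filtered_family \<K>"
    unfolding filtered_family_def
  proof (intro conjI ballI)
    have "topspace X \<inter> C \<noteq> {}"
      using C closedin_subset[OF clC] unfolding irreducible_closed_def by auto
    then show "\<K> \<noteq> {}" using small[of "topspace X"] by auto
  next
    fix K1 K2 assume "K1 \<in> \<K>" "K2 \<in> \<K>"
    then obtain O1 O2 where O12: "openin X O1" "O1 \<subseteq> K1" "O1 \<inter> C \<noteq> {}"
        "openin X O2" "O2 \<subseteq> K2" "O2 \<inter> C \<noteq> {}"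
      unfolding \<K>_def by blast
    then obtain K3 where "K3 \<in> \<K>" "K3 \<subseteq> O1 \<inter> O2"
      using small[of "O1 \<inter> O2"] meet by blast
    then show "\<exists>K3\<in>\<K>. K3 \<subseteq> K1 \<and> K3 \<subseteq> K2" using O12 by blast
  qed
  \<comment> \<open>Well-filteredness is applied to the complement of \<open>C\<close>: as no member
    of \<open>\<K>\<close> avoids \<open>C\<close>, neither does the intersection.\<close>
  moreover have "\<not> K \<subseteq> topspace X - C" if "K \<in> \<K>" for K
    using that unfolding \<K>_def by blast
  moreover have "openin X (topspace X - C)" using clC by auto
  moreover have "\<K> \<subseteq> KX X" unfolding \<K>_def by auto
  ultimately have "\<not> \<Inter>\<K> \<subseteq> topspace X - C"
    using wf unfolding well_filtered_space_def by blast
  then obtain x where x: "x \<in> \<Inter>\<K>" "x \<notin> topspace X - C" by blast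
  have "x \<in> topspace X"
  proof -
    obtain K where "K \<in> \<K>" using \<open>filtered_family \<K>\<close> unfolding filtered_family_def by auto
    then show ?thesis using x(1) unfolding \<K>_def KX_def saturatedin_def by auto
  qed
  with x have "x \<in> C" by auto
  have "C \<subseteq> X closure_of {x}"
  proof
    fix y assume y: "y \<in> C"
    \<comment> \<open>\<open>T\<close> meets \<open>C\<close> at \<open>y\<close>, so it contains a
      member of \<open>\<K>\<close> and thus \<open>x\<close>.\<close>
    have "x \<in> T" if "y \<in> T" "openin X T" for T
      using small[of T] that y x(1) by blast
    then show "y \<in> X closure_of {x}"
      using y closedin_subset[OF clC] unfolding in_closure_of by auto
  qed
  moreover have "X closure_of {x} \<subseteq> C"
    using \<open>x \<in> C\<close> clC by (intro closure_of_minimal) auto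
  ultimately show "\<exists>x. x \<in> topspace X \<and> C = X closure_of {x}"
    using \<open>x \<in> topspace X\<close> by blast
next
  fix C x y
  assume "x \<in> topspace X \<and> C = X closure_of {x}" "y \<in> topspace X \<and> C = X closure_of {y}"
  then show "x = y"
    using t0_space_closure_of_singleton_inj[of X x y] wf unfolding well_filtered_space_def by simp
qed

theorem mainTheorem19:
  fixes X :: "'a topology"
  assumes "t0_space X"
  shows "(loc_compact_space X \<and> sober_space X \<longleftrightarrow> loc_compact_space X \<and> well_filtered_space X)
       \<and> (loc_compact_space X \<and> well_filtered_space X \<longleftrightarrow> core_compact_space X \<and> sober_space X)
       \<and> (core_compact_space X \<and> sober_space X \<longleftrightarrow> core_compact_space X \<and> well_filtered_space X)"
  \<comment> \<open>Each of the four conditions implies core compact and well-filtered, which gives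
    local compactness and then sobriety.\<close>
  using sober_imp_well_filtered[of X] loc_compact_imp_core_compact[of X] assms
    core_compact_well_filtered_imp_loc_compact[of X] loc_compact_well_filtered_imp_sober[of X]
  by blast

end
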